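(* Let $f,g,F$ be as in the context (with $F=f+g$ and $F^*=\inf F>-\infty$). Suppose that for every $\gamma>0$ and $x\in\mathbb{E}$ the set $\mathrm{prox}_{g/\gamma}(x)$ is nonempty, and that there exists $L>0$ such that $$f(x)\le f(y)+\langle\nabla f(y),x-y\rangle+\frac{L}{2}\|x-y\|^2\quad\text{for all }x,y\in\mathrm{dom}\,g.$$ Let $\{x^k\}$ be a sequence generated by the auto-conditioned proximal gradient method (AC-PGM) with parameters $\alpha>1$, $L_0>0$ and initial point $x^0\in\mathrm{dom}\,g$, satisfying $x^k\neq x^{k-1}$ for all $k\ge1$. Then: (i) For all $k\ge1$, $$\min_{1\le l\le k}\|R_{\alpha\gamma_l}(x^{l-1})\|\le\sqrt{\frac{2\alpha^2\max\{L_0,L\}(2\Delta+C)}{(\alpha-1)k}}=\mathcal{O}\left(k^{-\frac12}\right),$$ where $\Delta:=F(x^0)-F^*$ and $C:=(\max\{L_0,L\}-L_0)\max_{l\in\overline{\mathcal{S}}}\|x^l-x^{l-1}\|^2<\infty$. (ii) The sequence $\{F(x^k)\}$ converges to a finite value, and any accumulation point of $\{x^k\}$ is an l-stationary point of the problem of minimizing $F$ over $\mathbb{E}$.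
   Context: $\mathbb{E}$ is a finite-dimensional real inner product space with inner product $\langle\cdot,\cdot\rangle$ and induced norm $\|\cdot\|$; $\mathrm{dom}\,\phi=\{x\mid\phi(x)<\infty\}$; $[k]=\{1,\dots,k\}$. Problem: minimize $F(x):=f(x)+g(x)$ over $x\in\mathbb{E}$, where $f:\mathbb{E}\to(-\infty,\infty]$ is lower semicontinuous and continuously differentiable on an open set including $\mathrm{dom}\,g$, $g:\mathbb{E}\to(-\infty,\infty]$ is proper and lower semicontinuous, and $F^*:=\inf_{x\in\mathbb{E}}F(x)>-\infty$. $\mathrm{prox}_{g/\gamma}(x):=\operatorname{argmin}_{y\in\mathbb{E}}\{g(y)+\frac{\gamma}{2}\|y-x\|^2\}$ (a set). Subdifferentials: for $x\in\mathrm{dom}\,F=\mathrm{dom}\,g$, the Fréchet subdifferential is $\widehat\partial F(x)=\{\xi\in\mathbb{E}\mid\liminf_{y\to x}\frac{F(y)-F(x)-\langle\xi,y-x\rangle}{\|y-x\|}\ge0\}$, with $\widehat\partial F(x)=\emptyset$ for $x\notin\mathrm{dom}\,g$; the limiting subdifferential is $\partial F(x)=\{\xi\mid\exists\,x^k\to x,\ F(x^k)\to F(x),\ \xi^k\to\xi,\ \xi^k\in\widehat\partial F(x^k)\}$. An l-stationary point is a point $x^*\in\mathrm{dom}\,g$ with $0\in\partial F(x^* )$. AC-PGM: given $x^0\in\mathrm{dom}\,g$, $\alpha>1$, $L_0>0$, for $k=1,2,\dots$ compute $\gamma_k=\max\{L_0,\dots,L_{k-1}\}$; $x^k\in\mathrm{prox}_{g/(\alpha\gamma_k)}\big(x^{k-1}-\frac{1}{\alpha\gamma_k}\nabla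 f(x^{k-1})\big)$ (any choice); $L_k=\dfrac{2\big(f(x^k)-f(x^{k-1})-\langle\nabla f(x^{k-1}),x^k-x^{k-1}\rangle\big)}{\|x^k-x^{k-1}\|^2}$. Gradient mapping along the iterates: $R_{\alpha\gamma_k}(x^{k-1}):=\alpha\gamma_k(x^{k-1}-x^k)$. Index sets: with $\beta:=\frac{\alpha+1}{2}$, $\mathcal{S}:=\{k\ge1\mid\beta\gamma_k\ge L_k\}$ and $\overline{\mathcal{S}}:=\{1,2,\dots\}\setminus\mathcal{S}$. A maximum over the empty set is taken to be $0$. *)

theory Defs
  imports "HOL-Analysis.Analysis" "HOL-Library.Landau_Symbols"
begin

text \<open>
  Functions $\phi : E \to (-\infty,\infty]$ are modelled as maps into \<^typ>\<open>ereal\<close>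
  that avoid $-\infty$.
\<close>

definition edom :: "('a \<Rightarrow> ereal) \<Rightarrow> 'a set"
  where "edom \<phi> = {x. \<phi> x < \<infinity>}"

definition proper :: "('a \<Rightarrow> ereal) \<Rightarrow> bool"
  where "proper \<phi> \<longleftrightarrow> (\<forall>x. - \<infinity> < \<phi> x) \<and> edom \<phi> \<noteq> {}"

definition lsc :: "('a::topological_space \<Rightarrow> ereal) \<Rightarrow> bool"
  where "lsc \<phi> \<longleftrightarrow> (\<forall>x. \<phi> x \<le> Liminf (at x) \<phi>)"

text \<open>
  The gradient is only meaningful at points near which the function is finite, since
  \<^const>\<open>real_of_ereal\<close> sends infinite values to 0; \<open>C1_on\<close> below ensures this on an open set.
\<close>

definition grad :: "('a::real_inner \<Rightarrow> ereal) \<Rightarrow> 'a \<Rightarrow> 'a"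
  where "grad \<phi> x = (THE D. GDERIV (\<lambda>y. real_of_ereal (\<phi> y)) x :> D)"

definition C1_on :: "('a::real_inner \<Rightarrow> ereal) \<Rightarrow> 'a set \<Rightarrow> bool"
  where "C1_on \<phi> U \<longleftrightarrow>
    open U \<and> (\<forall>x\<in>U. \<bar>\<phi> x\<bar> \<noteq> \<infinity>) \<and>
    (\<forall>x\<in>U. \<exists>D. GDERIV (\<lambda>y. real_of_ereal (\<phi> y)) x :> D) \<and>
    continuous_on U (grad \<phi>)"

text \<open>\<open>prox g \<gamma> x\<close> is the set $\mathrm{prox}_{g/\gamma}(x)$.\<close>

definition prox :: "('a::real_inner \<Rightarrow> ereal) \<Rightarrow> real \<Rightarrow> 'a \<Rightarrow> 'a set"
  where "prox g \<gamma> x =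
    {y. is_arg_min (\<lambda>y. g y + ereal (\<gamma> / 2 * (norm (y - x))\<^sup>2)) (\<lambda>_. True) y}"

definition frechet_subdiff :: "('a::real_inner \<Rightarrow> ereal) \<Rightarrow> 'a \<Rightarrow> 'a set"
  where "frechet_subdiff F x =
    (if x \<in> edom F
     then {\<xi>. 0 \<le> Liminf (at x)
            (\<lambda>y. (F y - F x - ereal (inner \<xi> (y - x))) / ereal (norm (y - x)))}
     else {})"

definition limiting_subdiff :: "('a::real_inner \<Rightarrow> ereal) \<Rightarrow> 'a \<Rightarrow> 'a set"
  where "limiting_subdiff F x =
    {\<xi>. \<exists>(u :: nat \<Rightarrow> 'a) (v :: nat \<Rightarrow> 'a).
          u \<longlonglongrightarrow> x \<and> (\<lambda>k. F (u k)) \<longlonglongrightarrow> F x \<and> v \<longlonglongrightarrow> \<xi> \<and>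
          (\<forall>k. v k \<in> frechet_subdiff F (u k))}"

definition l_stationary :: "('a::real_inner \<Rightarrow> ereal) \<Rightarrow> ('a \<Rightarrow> ereal) \<Rightarrow> 'a \<Rightarrow> bool"
  where "l_stationary f g z \<longleftrightarrow> z \<in> edom g \<and> 0 \<in> limiting_subdiff (\<lambda>x. f x + g x) z"

text \<open>
  A run of the auto-conditioned proximal gradient method: iterates \<open>x\<close>, step parameters \<open>\<gamma>\<close>
  (used from index 1 on) and curvature estimates \<open>L\<close>.
\<close>

definition ac_pgm ::
  "('a::real_inner \<Rightarrow> ereal) \<Rightarrow> ('a \<Rightarrow> ereal) \<Rightarrow> real \<Rightarrow> real \<Rightarrow> 'a \<Rightarrow>
   (nat \<Rightarrow> 'a) \<Rightarrow> (nat \<Rightarrow> real) \<Rightarrow> (nat \<Rightarrow> real) \<Rightarrow> bool"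
  where "ac_pgm f g \<alpha> L\<^sub>0 x\<^sub>0 x \<gamma> L \<longleftrightarrow>
    x 0 = x\<^sub>0 \<and> L 0 = L\<^sub>0 \<and>
    (\<forall>k\<ge>1.
       \<gamma> k = Max (L ` {0..k - 1}) \<and>
       x k \<in> prox g (\<alpha> * \<gamma> k) (x (k - 1) - (1 / (\<alpha> * \<gamma> k)) *\<^sub>R grad f (x (k - 1))) \<and>
       L k = 2 * (real_of_ereal (f (x k)) - real_of_ereal (f (x (k - 1)))
                  - inner (grad f (x (k - 1))) (x k - x (k - 1)))
             / (norm (x k - x (k - 1)))\<^sup>2)"

text \<open>The vector $R_{\alpha\gamma_k}(x^{k-1})$ along the iterates.\<close>

definition grad_map :: "real \<Rightarrow> (nat \<Rightarrow> 'a::real_vector) \<Rightarrow> (nat \<Rightarrow> real) \<Rightarrow> nat \<Rightarrow> 'a"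
  where "grad_map \<alpha> x \<gamma> k = (\<alpha> * \<gamma> k) *\<^sub>R (x (k - 1) - x k)"

text \<open>
  Extended-valued maximum with the convention $\max\emptyset = 0$. It is the supremum, so that
  finiteness and attainment are assertions rather than consequences of the definition.
\<close>

definition emax0 :: "ereal set \<Rightarrow> ereal"
  where "emax0 A = (if A = {} then 0 else Sup A)"

definition accumulation_point :: "(nat \<Rightarrow> 'a::topological_space) \<Rightarrow> 'a \<Rightarrow> bool"
  where "accumulation_point x z \<longleftrightarrow> (\<exists>r :: nat \<Rightarrow> nat. strict_mono r \<and> (x \<circ> r) \<longlonglongrightarrow> z)"

end

theory Submission
  imports Defs
begin

text \<open>
  Comparing the prox step with the previous iterate gives
  $F(x^k) + \frac{\alpha\gamma_k - L_k}{2}\|x^k - x^{k-1}\|^2 \le F(x^{k-1})$. On $\mathcal{S}$ this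
  is a decrease by at least $\frac{\alpha-1}{4}\gamma_k\|x^k-x^{k-1}\|^2$. Off $\mathcal{S}$ the
  excess $\frac{L_k-\beta\gamma_k}{2}$ is at most $\frac{\gamma_{k+1}-\gamma_k}{2}$, so that the
  excesses telescope to $\frac12(\max\{L_0,L\}-L_0)$; moreover $\gamma$ is monotone and bounded,
  hence convergent, which excludes $\gamma_{k+1} > \beta\gamma_k$ for large $k$. Therefore
  $\sum_k \|x^k-x^{k-1}\|^2 < \infty$ and $F(x^k)$ is eventually decreasing. At an accumulation
  point, the Fermat rule of the prox step yields Frechet subgradients
  $\nabla f(x^k) - \nabla f(x^{k-1}) - \alpha\gamma_k(x^k-x^{k-1})$ of $F$ at $x^k$ tending to $0$.
\<close>

section \<open>Lower semicontinuity, gradients, the prox step and a subdifferential sum rule\<close>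

lemma lsc_eventually_less:
  assumes "lsc \<phi>" "(u \<longlongrightarrow> z) net" "a < \<phi> z"
  shows "\<forall>\<^sub>F n in net. a < \<phi> (u n)"
proof -
  have "a < Liminf (at z) \<phi>"
    using assms(1,3) unfolding lsc_def by (meson less_le_trans)
  then have "\<forall>\<^sub>F y in at z. a < \<phi> y"
    by (rule less_LiminfD)
  \<comment> \<open>\<open>lsc\<close> is phrased with punctured neighbourhoods. The assumption on
    \<open>\<phi> z\<close> adds the centre, so nets that hit \<open>z\<close> are covered
    too.\<close>
  then have "\<forall>\<^sub>F y in nhds z. a < \<phi> y"
    using assms(3) by (auto simp: eventually_at_filter elim: eventually_mono)
  then show ?thesis
    using assms(2) unfolding filterlim_iff by blast
qed

lemma GDERIV_unique:
  assumes "GDERIV h x :> D" "GDERIV h x :> D'"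
  shows "D = D'"
proof -
  have "(\<lambda>h. inner h D) = (\<lambda>h. inner h D')"
    using has_derivative_unique assms unfolding gderiv_def by blast
  then have "inner (D - D') D = inner (D - D') D'"
    by metis
  then have "inner (D - D') (D - D') = 0"
    by (simp add: inner_diff_right)
  then show ?thesis by simp
qed

lemma C1_on_GDERIV:
  assumes "C1_on \<phi> U" "x \<in> U"
  shows "GDERIV (\<lambda>y. real_of_ereal (\<phi> y)) x :> grad \<phi> x"
proof -
  obtain D where "GDERIV (\<lambda>y. real_of_ereal (\<phi> y)) x :> D"
    using assms unfolding C1_on_def by blast
  then show ?thesis
    unfolding grad_def by (rule theI) (metis GDERIV_unique \<open>GDERIV _ x :> D\<close>)
qed

text \<open>Up to an additive constant, the prox objective at the shifted point
  \<open>p - (1 / c) *\<^sub>R v\<close> is the linearised model with slope \<open>v\<close> around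
  \<open>p\<close>. Minimality against a point of dom g also forces a finite value of g.\<close>

lemma prox_gradient_step:
  fixes g :: "'a::real_inner \<Rightarrow> ereal"
  assumes "c > 0" "\<And>y. - \<infinity> < g y" "y \<in> edom g"
    and z: "z \<in> prox g c (p - (1 / c) *\<^sub>R v)"
  shows "z \<in> edom g"
    and "real_of_ereal (g z) + inner v (z - p) + c / 2 * (norm (z - p))\<^sup>2
       \<le> real_of_ereal (g y) + inner v (y - p) + c / 2 * (norm (y - p))\<^sup>2"
proof -
  let ?q = "\<lambda>w. c / 2 * (norm (w - (p - (1 / c) *\<^sub>R v)))\<^sup>2"
  have le: "g z + ereal (?q z) \<le> g y + ereal (?q y)"
    using z unfolding prox_def is_arg_min_def by (auto simp: not_less)
  obtain b where b: "g y = ereal b"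
    using assms(2)[of y] assms(3) by (cases "g y") (auto simp: edom_def)
  obtain a where a: "g z = ereal a"
    using le b assms(2)[of z] by (cases "g z") auto
  show "z \<in> edom g" using a by (simp add: edom_def)
  \<comment> \<open>Completing the square: the last summand does not depend on \<open>w\<close> and
    cancels in the comparison.\<close>
  have q: "?q w = c / 2 * (norm (w - p))\<^sup>2 + inner v (w - p) + (norm v)\<^sup>2 / (2 * c)" for w
  proof -
    have "w - (p - (1 / c) *\<^sub>R v) = (w - p) + (1 / c) *\<^sub>R v" by simp
    then have "(norm (w - (p - (1 / c) *\<^sub>R v)))\<^sup>2
        = (norm (w - p))\<^sup>2 + 2 / c * inner v (w - p) + (norm v)\<^sup>2 / c\<^sup>2"
      unfolding power2_norm_eq_inner
      by (simp only: inner_add_left inner_add_right inner_scaleR_left inner_scaleR_right)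
        (simp add: inner_commute power2_eq_square add_divide_distrib)
    then show ?thesis
      using \<open>c > 0\<close> by (simp add: field_simps power2_eq_square)
  qed
  show "real_of_ereal (g z) + inner v (z - p) + c / 2 * (norm (z - p))\<^sup>2
       \<le> real_of_ereal (g y) + inner v (y - p) + c / 2 * (norm (y - p))\<^sup>2"
    using le unfolding a b q by simp
qed

text \<open>\<open>v\<close> acts as a proximal subgradient of g at \<open>p\<close>. Its quadratic
  error and the differentiability error of f are both of smaller order than the distance to
  \<open>p\<close>, so the quotient of the sum has nonnegative lower limit.\<close>

lemma frechet_subdiff_sumI:
  fixes f g :: "'a::real_inner \<Rightarrow> ereal"
  assumes D: "GDERIV (\<lambda>y. real_of_ereal (f y)) p :> D"
    and fin: "\<forall>\<^sub>F y in nhds p. \<bar>f y\<bar> \<noteq> \<infinity>"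
    and g: "\<And>y. - \<infinity> < g y" "p \<in> edom g"
    and v: "\<And>y. y \<in> edom g \<Longrightarrow> real_of_ereal (g y)
        \<ge> real_of_ereal (g p) + inner v (y - p) - c * (norm (y - p))\<^sup>2"
  shows "D + v \<in> frechet_subdiff (\<lambda>y. f y + g y) p"
proof -
  let ?f = "\<lambda>y. real_of_ereal (f y)" and ?g = "\<lambda>y. real_of_ereal (g y)"
  have fp: "f p = ereal (?f p)"
    using eventually_nhds_x_imp_x[OF fin] by (simp add: ereal_real)
  have gr: "g y = ereal (?g y)" if "y \<in> edom g" for y
    using g(1)[of y] that by (cases "g y") (auto simp: edom_def)
  note gp = gr[OF g(2)]
  have "0 \<le> Liminf (at p)
    (\<lambda>y. (f y + g y - (f p + g p) - ereal (inner (D + v) (y - p))) / ereal (norm (y - p)))"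
    (is "0 \<le> Liminf _ ?Q")
    unfolding le_Liminf_iff
  proof (intro allI impI)
    fix a :: ereal assume "a < 0"
    then obtain e where e: "a < ereal e" "ereal e < 0"
      using ereal_dense2 by blast
    \<comment> \<open>A split into thirds: f and g may each lose \<open>e'\<close> per unit of
      distance, and \<open>- (2 * e')\<close> still exceeds \<open>e\<close>.\<close>
    define e' where "e' = - e / 3"
    have e': "e' > 0" using e(2) by (simp add: e'_def)
    obtain d where d: "d > 0"
      "\<And>y. norm (y - p) < d \<Longrightarrow> norm (?f y - ?f p - inner (y - p) D) \<le> e' * norm (y - p)"
      using D e' unfolding gderiv_def has_derivative_at_alt by blast
    \<comment> \<open>The second bound makes \<open>c\<close> times the distance at most
      \<open>e'\<close>; the added 1 keeps the denominator positive.\<close>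
    define d' where "d' = min d (e' / (\<bar>c\<bar> + 1))"
    have d': "d' > 0" using d(1) e' by (simp add: d'_def)
    have "\<forall>\<^sub>F y in at p. dist y p < d'"
      using d' by (auto simp: eventually_at)
    moreover have "\<forall>\<^sub>F y in at p. \<bar>f y\<bar> \<noteq> \<infinity>"
      using fin by (simp add: eventually_nhds_conv_at)
    moreover have "\<forall>\<^sub>F y in at p. y \<noteq> p"
      by (simp add: eventually_at_filter)
    ultimately show "\<forall>\<^sub>F y in at p. a < ?Q y"
    proof eventually_elim
      case (elim y)
      define n where "n = norm (y - p)"
      have n: "n > 0" using elim(3) by (simp add: n_def)
      have nd: "n < d" "n < e' / (\<bar>c\<bar> + 1)"
        using elim(1) by (simp_all add: n_def d'_def dist_norm)
      have fy: "f y = ereal (?f y)" using elim(2) by (simp add: ereal_real)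
      show ?case
      proof (cases "y \<in> edom g")
        \<comment> \<open>Outside dom g the numerator is infinite while the denominator is finite
          and positive.\<close>
        case False
        then have "g y = \<infinity>" by (simp add: edom_def)
        then have "?Q y = \<infinity>"
          using n fp gp unfolding n_def[symmetric] by (subst fy, subst fp, subst gp) simp
        then show ?thesis using e(1) by auto
      next
        case True
        have "n * (\<bar>c\<bar> + 1) < e'"
          using nd(2) by (simp add: pos_less_divide_eq)
        then have cn: "c * n \<le> e'"
          using n by (smt (verit) mult.commute mult_right_mono distrib_left mult_cancel_left1)
        have "c * n\<^sup>2 \<le> e' * n"
          using mult_right_mono[OF cn, of n] n by (simp add: power2_eq_square mult.assoc)
        moreover have "?f y - ?f p - inner D (y - p) \<ge> - (e' * n)"
          using d(2)[of y] nd(1) by (simp add: n_def inner_commute abs_le_iff)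
        moreover have "?g y - ?g p - inner v (y - p) \<ge> - (c * n\<^sup>2)"
          using v[OF True] by (simp add: n_def)
        ultimately have "- (2 * e') * n \<le> ?f y + ?g y - (?f p + ?g p) - inner (D + v) (y - p)"
          by (simp add: inner_add_left)
        then have "- (2 * e') \<le> (?f y + ?g y - (?f p + ?g p) - inner (D + v) (y - p)) / n"
          using n by (simp add: pos_le_divide_eq)
        moreover have "e < - (2 * e')" using e' by (simp add: e'_def)
        ultimately have "ereal e < ?Q y"
          using n unfolding n_def[symmetric]
          by (subst fy, subst fp, subst gp, subst gr[OF True]) simp
        then show ?thesis using e(1) by simp
      qed
    qed
  qed
  moreover have "p \<in> edom (\<lambda>y. f y + g y)"
    unfolding edom_def by (simp, subst fp, subst gp, simp)
  ultimately show ?thesis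
    by (simp add: frechet_subdiff_def)
qed

section \<open>From a bound on a sum of squares to the rate\<close>

lemma Min_le_sqrt_average:
  fixes a :: "nat \<Rightarrow> real"
  assumes "k \<ge> 1" "\<And>l. a l \<ge> 0" "(\<Sum>l=1..k. (a l)\<^sup>2) \<le> K"
  shows "Min (a ` {1..k}) \<le> sqrt (K / real k)"
proof -
  let ?m = "Min (a ` {1..k})"
  have "?m \<in> a ` {1..k}" using assms(1) by (intro Min_in) auto
  then have "?m \<ge> 0" using assms(2) by auto
  then have "?m\<^sup>2 \<le> (a l)\<^sup>2" if "l \<in> {1..k}" for l
    using that by (intro power_mono Min_le) auto
  then have "(\<Sum>l=1..k. ?m\<^sup>2) \<le> (\<Sum>l=1..k. (a l)\<^sup>2)"
    by (rule sum_mono)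
  then have "real k * ?m\<^sup>2 \<le> K" using assms(3) by simp
  then have "?m\<^sup>2 \<le> K / real k"
    using assms(1) by (simp add: field_simps)
  then show ?thesis by (rule real_le_rsqrt)
qed

lemma sqrt_inverse_bigo: "(\<lambda>k. sqrt (A / (B * real k))) \<in> O(\<lambda>k. real k powr (- 1 / 2))"
proof (rule bigoI)
  show "\<forall>\<^sub>F k in sequentially. norm (sqrt (A / (B * real k)))
      \<le> sqrt \<bar>A / B\<bar> * norm (real k powr (- 1 / 2))"
    using eventually_gt_at_top[of 0]
  proof eventually_elim
    case (elim k)
    have "real k powr (- 1 / 2) = 1 / sqrt (real k)"
      using elim by (simp add: powr_minus_divide powr_half_sqrt)
    \<comment> \<open>The real \<open>sqrt\<close> is odd, so this covers either sign of
      \<open>A / B\<close>.\<close>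
    moreover have "\<bar>sqrt y\<bar> = sqrt \<bar>y\<bar>" for y
      by (simp add: abs_if real_sqrt_minus)
    then have "\<bar>sqrt (A / (B * real k))\<bar> = sqrt \<bar>A / B\<bar> / sqrt (real k)"
      by (simp add: abs_mult flip: real_sqrt_divide)
    ultimately show ?case by simp
  qed
qed

section \<open>The run of the method: finiteness and step parameters\<close>

locale ac_pgm_run =
  fixes f g :: "'a::euclidean_space \<Rightarrow> ereal"
    and \<alpha> L\<^sub>0 L\<^sub>f :: real and x\<^sub>0 :: 'a
    and x :: "nat \<Rightarrow> 'a" and \<gamma> L :: "nat \<Rightarrow> real" and U :: "'a set"
  assumes f_ninf: "\<And>y. - \<infinity> < f y" and lsc_f: "lsc f"
    and dom_U: "edom g \<subseteq> U" and C1: "C1_on f U"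
    and proper_g: "proper g" and lsc_g: "lsc g"
    and bdd: "- \<infinity> < (INF y. f y + g y)"
    and upper: "\<And>y z. y \<in> edom g \<Longrightarrow> z \<in> edom g \<Longrightarrow>
           f y \<le> f z + ereal (inner (grad f z) (y - z) + L\<^sub>f / 2 * (norm (y - z))\<^sup>2)"
    and alpha: "\<alpha> > 1" and L0: "L\<^sub>0 > 0" and x0: "x\<^sub>0 \<in> edom g"
    and run: "ac_pgm f g \<alpha> L\<^sub>0 x\<^sub>0 x \<gamma> L"
    and moves: "\<And>k. 1 \<le> k \<Longrightarrow> x k \<noteq> x (k - 1)"
begin

definition fr where "fr y = real_of_ereal (f y)"
definition gr where "gr y = real_of_ereal (g y)"
definition Fx where "Fx k = fr (x k) + gr (x k)"
text \<open>Indexed by the starting point: \<open>step k\<close> belongs to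
  \<open>\<gamma> (Suc k)\<close> and \<open>L (Suc k)\<close>, which avoids subtraction on
  indices.\<close>

definition step where "step k = norm (x (Suc k) - x k)"

lemma g_ninf: "- \<infinity> < g y"
  using proper_g by (simp add: proper_def)

lemma open_U: "open U"
  and f_fin: "y \<in> U \<Longrightarrow> \<bar>f y\<bar> \<noteq> \<infinity>"
  and grad_cont: "continuous_on U (grad f)"
  using C1 by (auto simp: C1_on_def)

lemma f_real: "y \<in> edom g \<Longrightarrow> f y = ereal (fr y)"
  using f_fin dom_U unfolding fr_def by (metis ereal_real' subsetD)

lemma g_real: "y \<in> edom g \<Longrightarrow> g y = ereal (gr y)"
  using g_ninf[of y] by (cases "g y") (auto simp: edom_def gr_def)

lemma gamma_1: "\<gamma> 1 = L\<^sub>0"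
  using run by (simp add: ac_pgm_def)

lemma gamma_Suc: "\<gamma> (Suc (Suc k)) = max (\<gamma> (Suc k)) (L (Suc k))"
proof -
  have "\<gamma> (Suc (Suc k)) = Max (L ` {0..Suc k})" "\<gamma> (Suc k) = Max (L ` {0..k})"
    using run by (simp_all add: ac_pgm_def)
  then show ?thesis
    by (simp add: atLeast0_atMost_Suc max.commute)
qed

text \<open>A run leaves \<open>\<gamma> 0\<close> unspecified, hence the shift by one here and
  below.\<close>

lemma incseq_gamma: "incseq (\<lambda>k. \<gamma> (Suc k))"
  by (rule incseq_SucI) (simp add: gamma_Suc)

lemma gamma_ge: "L\<^sub>0 \<le> \<gamma> (Suc k)"
  using incseqD[OF incseq_gamma, of 0 k] gamma_1 by simp

lemma gamma_pos: "0 < \<gamma> (Suc k)"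
  using gamma_ge[of k] L0 by simp

lemma prox_Suc:
  "x (Suc k) \<in> prox g (\<alpha> * \<gamma> (Suc k)) (x k - (1 / (\<alpha> * \<gamma> (Suc k))) *\<^sub>R grad f (x k))"
proof -
  have "x l \<in> prox g (\<alpha> * \<gamma> l) (x (l - 1) - (1 / (\<alpha> * \<gamma> l)) *\<^sub>R grad f (x (l - 1)))"
    if "l \<ge> 1" for l
    using run that unfolding ac_pgm_def by blast
  from this[of "Suc k"] show ?thesis by simp
qed

lemma alpha_gamma_pos: "0 < \<alpha> * \<gamma> (Suc k)"
  using alpha gamma_pos by simp

lemma x_dom: "x k \<in> edom g"
proof (induction k)
  case 0
  then show ?case using run x0 by (simp add: ac_pgm_def)
next
  case (Suc k)
  show ?case
    by (rule prox_gradient_step(1)[OF alpha_gamma_pos g_ninf Suc prox_Suc])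
qed

lemma prox_le:
  assumes "y \<in> edom g"
  shows "gr (x (Suc k)) + inner (grad f (x k)) (x (Suc k) - x k)
       + \<alpha> * \<gamma> (Suc k) / 2 * (norm (x (Suc k) - x k))\<^sup>2
     \<le> gr y + inner (grad f (x k)) (y - x k) + \<alpha> * \<gamma> (Suc k) / 2 * (norm (y - x k))\<^sup>2"
  using prox_gradient_step(2)[OF alpha_gamma_pos g_ninf assms prox_Suc] by (simp add: gr_def)

lemma step_pos: "step k > 0"
  using moves[of "Suc k"] by (simp add: step_def)

text \<open>The curvature estimate is the coefficient that makes the quadratic expansion of f exact.
  Since the iterates move, the defining quotient can be multiplied out.\<close>

lemma f_Suc:
  "fr (x (Suc k)) = fr (x k) + inner (grad f (x k)) (x (Suc k) - x k)
     + L (Suc k) / 2 * (step k)\<^sup>2"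
proof -
  have "L (Suc k) = 2 * (fr (x (Suc k)) - fr (x k) - inner (grad f (x k)) (x (Suc k) - x k))
      / (step k)\<^sup>2"
    using run by (simp add: ac_pgm_def fr_def step_def)
  then show ?thesis using step_pos[of k] by (simp add: field_simps)
qed

text \<open>Comparing the exact expansion with the upper model of f compares only the quadratic
  coefficients; the squared step is positive and can be divided out.\<close>

lemma L_le: "L (Suc k) \<le> L\<^sub>f"
proof -
  have "fr (x (Suc k)) \<le> fr (x k) + (inner (grad f (x k)) (x (Suc k) - x k)
      + L\<^sub>f / 2 * (step k)\<^sup>2)"
    using upper[OF x_dom[of "Suc k"] x_dom[of k]]
    by (simp add: f_real[OF x_dom] step_def)
  then have "L (Suc k) * (step k)\<^sup>2 \<le> L\<^sub>f * (step k)\<^sup>2"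
    unfolding f_Suc by simp
  then show ?thesis using step_pos[of k] by simp
qed

lemma gamma_le: "\<gamma> (Suc k) \<le> max L\<^sub>0 L\<^sub>f"
proof (induction k)
  case 0
  then show ?case using gamma_1 by simp
next
  case (Suc k)
  then show ?case using L_le[of k] unfolding gamma_Suc by linarith
qed

section \<open>Descent, summability of the squared steps and convergence of the values\<close>

lemma descent: "Fx (Suc k) + (\<alpha> * \<gamma> (Suc k) - L (Suc k)) / 2 * (step k)\<^sup>2 \<le> Fx k"
proof -
  \<comment> \<open>The prox inequality at the previous iterate. Its inner product cancels against
    the one in the expansion of f.\<close>
  have "gr (x (Suc k)) + inner (grad f (x k)) (x (Suc k) - x k)
      + \<alpha> * \<gamma> (Suc k) / 2 * (step k)\<^sup>2 \<le> gr (x k)"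
    using prox_le[OF x_dom[of k], of k] by (simp add: step_def)
  then show ?thesis
    unfolding Fx_def f_Suc by (simp add: algebra_simps diff_divide_distrib)
qed

text \<open>The limit \<open>c\<close> of \<gamma> is positive and bounds every estimate, because an
  estimate enters the next maximum. As the factor \<open>(\<alpha> + 1) / 2\<close> exceeds 1, it
  lifts \<gamma> above \<open>c\<close> eventually.\<close>

lemma eventually_good: "\<forall>\<^sub>F k in sequentially. L (Suc k) < (\<alpha> + 1) / 2 * \<gamma> (Suc k)"
proof -
  obtain c where c: "(\<lambda>k. \<gamma> (Suc k)) \<longlonglongrightarrow> c" "\<And>k. \<gamma> (Suc k) \<le> c"
    using incseq_convergent[OF incseq_gamma] gamma_le by blast
  have "c > 0" using c(2)[of 0] gamma_pos[of 0] by simp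
  then have "c < (\<alpha> + 1) / 2 * c" using alpha by simp
  moreover have "(\<lambda>k. (\<alpha> + 1) / 2 * \<gamma> (Suc k)) \<longlonglongrightarrow> (\<alpha> + 1) / 2 * c"
    by (intro tendsto_intros c)
  ultimately have "\<forall>\<^sub>F k in sequentially. c < (\<alpha> + 1) / 2 * \<gamma> (Suc k)"
    by (rule order_tendstoD(1)[rotated])
  then show ?thesis
  proof eventually_elim
    case (elim k)
    have "L (Suc k) \<le> c" using c(2)[of "Suc k"] by (simp add: gamma_Suc)
    then show ?case using elim by simp
  qed
qed

text \<open>Here \<open>m\<close> bounds the squared steps at bad indices, so the increments of
  \<gamma> that pay for them telescope with a common factor.\<close>

lemma sum_step_le:
  assumes m: "m \<ge> 0"
    and bad: "\<And>k. (\<alpha> + 1) / 2 * \<gamma> (Suc k) < L (Suc k) \<Longrightarrow> (step k)\<^sup>2 \<le> m"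
  shows "(\<alpha> - 1) / 4 * (\<Sum>k<n. \<gamma> (Suc k) * (step k)\<^sup>2) \<le> Fx 0 - Fx n + (\<gamma> (Suc n) - L\<^sub>0) / 2 * m"
proof (induction n)
  case 0
  then show ?case using gamma_1 by simp
next
  case (Suc n)
  let ?s = "(step n)\<^sup>2" and ?c = "\<gamma> (Suc n)" and ?l = "L (Suc n)" and ?c' = "\<gamma> (Suc (Suc n))"
  have "(?l - (\<alpha> + 1) / 2 * ?c) * ?s \<le> (?c' - ?c) * m"
  proof (cases "(\<alpha> + 1) / 2 * ?c < ?l")
    case True
    \<comment> \<open>As the factor is at least 1, the excess of \<open>?l\<close> over it is at
      most \<open>?l - ?c\<close>, and \<open>?l\<close> enters the next maximum
      \<open>?c'\<close>.\<close>
    have "1 * ?c \<le> (\<alpha> + 1) / 2 * ?c"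
      using alpha gamma_pos[of n] by (intro mult_right_mono) auto
    then have "?l - (\<alpha> + 1) / 2 * ?c \<le> ?c' - ?c"
      by (simp add: gamma_Suc)
    then show ?thesis
      using bad[OF True] True by (intro mult_mono) (auto simp: gamma_Suc)
  next
    case False
    then have "(?l - (\<alpha> + 1) / 2 * ?c) * ?s \<le> 0"
      by (simp add: mult_nonpos_nonneg)
    also have "0 \<le> (?c' - ?c) * m" using m by (simp add: gamma_Suc)
    finally show ?thesis .
  qed
  \<comment> \<open>The constant is half of \<open>\<alpha> - (\<alpha> + 1) / 2\<close>, the margin
    between the prox coefficient and the threshold for good indices.\<close>
  then have "(\<alpha> - 1) / 4 * (?c * ?s)
      \<le> (\<alpha> * ?c - ?l) / 2 * ?s + (?c' - ?c) / 2 * m"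
    by (simp add: field_simps)
  also have "\<dots> \<le> Fx n - Fx (Suc n) + (?c' - ?c) / 2 * m"
    using descent[of n] by simp
  finally show ?case
    using Suc by (simp add: algebra_simps add_divide_distrib diff_divide_distrib)
qed

lemma F_real: "f (x k) + g (x k) = ereal (Fx k)"
  by (simp add: f_real[OF x_dom] g_real[OF x_dom] Fx_def)

lemma INF_le_Fx: "real_of_ereal (INF y. f y + g y) \<le> Fx k"
proof -
  have le: "(INF y. f y + g y) \<le> ereal (Fx k)"
    unfolding F_real[symmetric] by (rule INF_lower) simp
  \<comment> \<open>The infimum lies between minus infinity, excluded by \<open>bdd\<close>, and a
    real number, so its conversion to a real is faithful.\<close>
  then show ?thesis
    using bdd by (cases "INF y. f y + g y") auto
qed

text \<open>The right-hand side no longer depends on \<open>n\<close>; this serves both summability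
  and the rate.\<close>

lemma sum_step_le_gap:
  assumes m: "m \<ge> 0"
    and bad: "\<And>k. (\<alpha> + 1) / 2 * \<gamma> (Suc k) < L (Suc k) \<Longrightarrow> (step k)\<^sup>2 \<le> m"
  shows "(\<alpha> - 1) / 4 * (\<Sum>k<n. \<gamma> (Suc k) * (step k)\<^sup>2)
    \<le> Fx 0 - real_of_ereal (INF y. f y + g y) + (max L\<^sub>0 L\<^sub>f - L\<^sub>0) / 2 * m"
proof -
  have "(\<gamma> (Suc n) - L\<^sub>0) / 2 * m \<le> (max L\<^sub>0 L\<^sub>f - L\<^sub>0) / 2 * m"
    using gamma_le[of n] m by (intro mult_right_mono) auto
  with sum_step_le[OF m bad, of n] INF_le_Fx[of n] show ?thesis by linarith
qed

text \<open>Finiteness supplies the bound \<open>m\<close> and later makes the supremum in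
  \<open>C\<close> an attained maximum.\<close>

lemma finite_bad: "finite {k. (\<alpha> + 1) / 2 * \<gamma> (Suc k) < L (Suc k)}"
proof -
  obtain N where "\<And>k. k \<ge> N \<Longrightarrow> L (Suc k) < (\<alpha> + 1) / 2 * \<gamma> (Suc k)"
    using eventually_good unfolding eventually_sequentially by blast
  then have "{k. (\<alpha> + 1) / 2 * \<gamma> (Suc k) < L (Suc k)} \<subseteq> {..<N}"
    by (smt (verit) Collect_mem_eq Collect_mono_iff lessThan_iff mem_Collect_eq not_less)
  then show ?thesis by (rule finite_subset) simp
qed

lemma step_tendsto: "step \<longlonglongrightarrow> 0"
proof -
  let ?B = "{k. (\<alpha> + 1) / 2 * \<gamma> (Suc k) < L (Suc k)}"
  \<comment> \<open>Any common bound on the finitely many bad squared steps will do; their sum is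
    one, also when there are none.\<close>
  define m where "m = (\<Sum>k\<in>?B. (step k)\<^sup>2)"
  have m: "m \<ge> 0" by (simp add: m_def sum_nonneg)
  have bad: "(step k)\<^sup>2 \<le> m" if "(\<alpha> + 1) / 2 * \<gamma> (Suc k) < L (Suc k)" for k
    unfolding m_def using that finite_bad by (intro member_le_sum) auto
  let ?K = "Fx 0 - real_of_ereal (INF y. f y + g y) + (max L\<^sub>0 L\<^sub>f - L\<^sub>0) / 2 * m"
  have c: "(\<alpha> - 1) / 4 * L\<^sub>0 > 0" using alpha L0 by simp
  have "(\<Sum>k<n. (step k)\<^sup>2) \<le> ?K / ((\<alpha> - 1) / 4 * L\<^sub>0)" for n
  proof -
    \<comment> \<open>The lower bound \<open>L\<^sub>0\<close> on \<gamma> removes the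
      weights.\<close>
    have "L\<^sub>0 * (\<Sum>k<n. (step k)\<^sup>2) \<le> (\<Sum>k<n. \<gamma> (Suc k) * (step k)\<^sup>2)"
      unfolding sum_distrib_left by (intro sum_mono mult_right_mono gamma_ge) auto
    then have "(\<alpha> - 1) / 4 * (L\<^sub>0 * (\<Sum>k<n. (step k)\<^sup>2))
        \<le> (\<alpha> - 1) / 4 * (\<Sum>k<n. \<gamma> (Suc k) * (step k)\<^sup>2)"
      using alpha by (intro mult_left_mono) auto
    also have "\<dots> \<le> ?K" by (rule sum_step_le_gap[OF m bad])
    finally show ?thesis using c by (simp add: pos_le_divide_eq mult_ac)
  qed
  then have "summable (\<lambda>k. (step k)\<^sup>2)"
    by (intro summableI_nonneg_bounded) auto
  then have "(\<lambda>k. (step k)\<^sup>2) \<longlonglongrightarrow> 0" by (rule summable_LIMSEQ_zero)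
  then have "(\<lambda>k. sqrt ((step k)\<^sup>2)) \<longlonglongrightarrow> 0"
    using tendsto_real_sqrt by fastforce
  then show ?thesis using step_pos by (simp add: less_imp_le)
qed

text \<open>At good indices the quadratic term in \<open>descent\<close> is nonnegative, since
  \<open>(\<alpha> + 1) / 2\<close> is below \<alpha>. A tail is thus decreasing and bounded below
  by the infimum.\<close>

lemma Fx_converges: "\<exists>c. Fx \<longlonglongrightarrow> c"
proof -
  obtain N where N: "\<And>k. k \<ge> N \<Longrightarrow> L (Suc k) < (\<alpha> + 1) / 2 * \<gamma> (Suc k)"
    using eventually_good unfolding eventually_sequentially by blast
  have "Fx (Suc k) \<le> Fx k" if "k \<ge> N" for k
  proof -
    have "(\<alpha> + 1) / 2 * \<gamma> (Suc k) \<le> \<alpha> * \<gamma> (Suc k)"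
      using alpha gamma_pos[of k] by (intro mult_right_mono) auto
    then have "0 \<le> (\<alpha> * \<gamma> (Suc k) - L (Suc k)) / 2 * (step k)\<^sup>2"
      using N[OF that] by simp
    then show ?thesis using descent[of k] by simp
  qed
  then have "decseq (\<lambda>k. Fx (k + N))"
    by (intro decseq_SucI) simp
  then obtain c where "(\<lambda>k. Fx (k + N)) \<longlonglongrightarrow> c"
    using decseq_convergent INF_le_Fx by metis
  then show ?thesis using LIMSEQ_offset by blast
qed

section \<open>Stationarity of accumulation points\<close>

lemma subgradient:
  "grad f (x (Suc k)) - grad f (x k) - (\<alpha> * \<gamma> (Suc k)) *\<^sub>R (x (Suc k) - x k)
     \<in> frechet_subdiff (\<lambda>y. f y + g y) (x (Suc k))"
proof -
  let ?p = "x (Suc k)" and ?q = "x k" and ?c = "\<alpha> * \<gamma> (Suc k)"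
  let ?v = "- grad f ?q - ?c *\<^sub>R (?p - ?q)"
  have pU: "?p \<in> U" using x_dom dom_U by auto
  have "grad f ?p + ?v \<in> frechet_subdiff (\<lambda>y. f y + g y) ?p"
  proof (rule frechet_subdiff_sumI[where c = "?c / 2"])
    show "GDERIV (\<lambda>y. real_of_ereal (f y)) ?p :> grad f ?p"
      by (rule C1_on_GDERIV[OF C1 pU])
    show "\<forall>\<^sub>F y in nhds ?p. \<bar>f y\<bar> \<noteq> \<infinity>"
      using eventually_nhds_in_open[OF open_U pU] by (rule eventually_mono) (rule f_fin)
    show "- \<infinity> < g y" for y by (rule g_ninf)
    show "?p \<in> edom g" by (rule x_dom)
    fix y assume y: "y \<in> edom g"
    \<comment> \<open>Recentring the square at the new iterate: the cross term becomes the linear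
      part of \<open>?v\<close>, and the remaining square is the proximal error with constant
      \<open>?c / 2\<close>.\<close>
    have "(norm (y - ?q))\<^sup>2 = (norm (y - ?p + (?p - ?q)))\<^sup>2" by simp
    also have "\<dots> = (norm (y - ?p))\<^sup>2 + 2 * inner (?p - ?q) (y - ?p) + (norm (?p - ?q))\<^sup>2"
      unfolding power2_norm_eq_inner
      by (simp only: inner_add_left inner_add_right) (simp add: inner_commute)
    finally have n: "(norm (y - ?q))\<^sup>2
        = (norm (y - ?p))\<^sup>2 + 2 * inner (?p - ?q) (y - ?p) + (norm (?p - ?q))\<^sup>2" .
    have i: "inner ?v (y - ?p) = inner (grad f ?q) (?p - ?q) - inner (grad f ?q) (y - ?q)
        - ?c * inner (?p - ?q) (y - ?p)"
      by (simp add: inner_diff_left inner_diff_right algebra_simps)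
    have "gr ?p + inner (grad f ?q) (?p - ?q) + ?c / 2 * (norm (?p - ?q))\<^sup>2
        \<le> gr y + inner (grad f ?q) (y - ?q) + ?c / 2 * (norm (y - ?q))\<^sup>2"
      by (rule prox_le[OF y])
    then have "gr y \<ge> gr ?p + inner ?v (y - ?p) - ?c / 2 * (norm (y - ?p))\<^sup>2"
      unfolding n i distrib_left by simp
    then show "real_of_ereal (g y)
        \<ge> real_of_ereal (g ?p) + inner ?v (y - ?p) - ?c / 2 * (norm (y - ?p))\<^sup>2"
      by (simp add: gr_def)
  qed
  then show ?thesis by (simp add: algebra_simps)
qed

lemma accumulation_in_edom:
  assumes u: "(\<lambda>j. x (r j)) \<longlonglongrightarrow> z" and r: "filterlim r sequentially sequentially"
  shows "z \<in> edom g"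
proof (rule ccontr)
  assume "z \<notin> edom g"
  then have gz: "g z = \<infinity>" by (simp add: edom_def)
  obtain c where "Fx \<longlonglongrightarrow> c" using Fx_converges by blast
  then have "(\<lambda>j. Fx (r j)) \<longlonglongrightarrow> c" using filterlim_compose r by blast
  then have F: "\<forall>\<^sub>F j in sequentially. Fx (r j) < c + 1"
    by (rule order_tendstoD) simp
  \<comment> \<open>\<open>z\<close> is not yet known to lie in \<open>U\<close>, so lower
    semicontinuity rather than smoothness bounds f from below near \<open>z\<close>. Then g is
    forced above \<open>c + 1 - a\<close>, contradicting the bounded values of F.\<close>
  obtain a where a: "ereal a < f z"
    using ereal_dense2[OF f_ninf[of z]] by blast
  have g: "\<forall>\<^sub>F j in sequentially. ereal (c + 1 - a) < g (x (r j))"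
    by (rule lsc_eventually_less[OF lsc_g u]) (simp add: gz)
  have "\<forall>\<^sub>F j in sequentially. False"
    using F g lsc_eventually_less[OF lsc_f u a]
    by eventually_elim (simp add: f_real[OF x_dom] g_real[OF x_dom] Fx_def)
  then show False by simp
qed

lemma accumulation_l_stationary:
  assumes "accumulation_point x z"
  shows "l_stationary f g z"
proof -
  obtain r where r: "strict_mono r" "(x \<circ> r) \<longlonglongrightarrow> z"
    using assms unfolding accumulation_point_def by blast
  \<comment> \<open>The shift to \<open>Suc j\<close> guarantees a positive index, so that every
    selected iterate is the result of a prox step from \<open>x (s j)\<close>.\<close>
  define s where "s j = r (Suc j) - 1" for j
  have s: "Suc (s j) = r (Suc j)" for j
    using strict_mono_imp_increasing[OF r(1), of "Suc j"] by (simp add: s_def)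
  have u: "(\<lambda>j. x (Suc (s j))) \<longlonglongrightarrow> z"
    using LIMSEQ_Suc[OF r(2)] by (simp add: s comp_def)
  have "strict_mono s"
  proof (rule strict_monoI)
    fix i j :: nat assume "i < j"
    then have "Suc (s i) < Suc (s j)" unfolding s using r(1) by (simp add: strict_mono_less)
    then show "s i < s j" by simp
  qed
  then have s_lim: "filterlim s sequentially sequentially" by (rule filterlim_subseq)
  have st: "(\<lambda>j. step (s j)) \<longlonglongrightarrow> 0"
    using filterlim_compose[OF step_tendsto s_lim] by simp
  have diff: "(\<lambda>j. x (Suc (s j)) - x (s j)) \<longlonglongrightarrow> 0"
    using st unfolding step_def by (rule tendsto_norm_zero_cancel)
  \<comment> \<open>Vanishing steps carry the limit over to the predecessors, so both ends of each
    selected step tend to \<open>z\<close>.\<close>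
  have w: "(\<lambda>j. x (s j)) \<longlonglongrightarrow> z"
    using tendsto_diff[OF u diff] by simp
  have z: "z \<in> edom g"
    by (rule accumulation_in_edom[OF w s_lim])
  then have zU: "z \<in> U" using dom_U by blast
  have grad_z: "isCont (grad f) z"
    using grad_cont open_U zU by (simp add: continuous_on_eq_continuous_at)
  note gu = isCont_tendsto_compose[OF grad_z u] and gw = isCont_tendsto_compose[OF grad_z w]
  have "isCont (\<lambda>y. real_of_ereal (f y)) z"
    using C1_on_GDERIV[OF C1 zU] unfolding gderiv_def by (rule has_derivative_continuous)
  then have f_lim: "(\<lambda>j. fr (x (Suc (s j)))) \<longlonglongrightarrow> fr z"
    unfolding fr_def by (rule isCont_tendsto_compose[OF _ u])

  \<comment> \<open>Boundedness of \<gamma> preserves null sequences; used for the quadratic term of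
    \<open>?h\<close> and for the subgradients.\<close>
  have bounded: "(\<lambda>j. \<alpha> * \<gamma> (Suc (s j)) * t j) \<longlonglongrightarrow> 0" if "t \<longlonglongrightarrow> 0" for t :: "nat \<Rightarrow> real"
  proof (rule Lim_null_comparison)
    show "\<forall>\<^sub>F j in sequentially. norm (\<alpha> * \<gamma> (Suc (s j)) * t j) \<le> \<alpha> * max L\<^sub>0 L\<^sub>f * \<bar>t j\<bar>"
      using alpha gamma_pos gamma_le
      by (intro always_eventually allI) (auto simp: abs_mult less_imp_le
          intro!: mult_right_mono mult_left_mono)
    show "(\<lambda>j. \<alpha> * max L\<^sub>0 L\<^sub>f * \<bar>t j\<bar>) \<longlonglongrightarrow> 0"
      using that by (intro tendsto_mult_right_zero tendsto_rabs_zero)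
  qed

  \<comment> \<open>The prox inequality at \<open>z\<close>, solved for the value of g at the new
    iterate, with the nonnegative quadratic term on the left dropped.\<close>
  let ?h = "\<lambda>j. gr z + inner (grad f (x (s j))) (z - x (s j))
      + \<alpha> * \<gamma> (Suc (s j)) * ((norm (z - x (s j)))\<^sup>2 / 2)
      - inner (grad f (x (s j))) (x (Suc (s j)) - x (s j))"
  have "(\<lambda>j. (norm (z - x (s j)))\<^sup>2 / 2) \<longlonglongrightarrow> (norm (z - z))\<^sup>2 / 2"
    by (intro tendsto_intros w) simp
  then have "?h \<longlonglongrightarrow> gr z + inner (grad f z) (z - z) + 0 - inner (grad f z) 0"
    by (intro tendsto_intros gw w diff bounded) simp
  then have h_lim: "?h \<longlonglongrightarrow> gr z" by simp
  have g_le: "gr (x (Suc (s j))) \<le> ?h j" for j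
  proof -
    have "0 \<le> \<alpha> * \<gamma> (Suc (s j)) / 2 * (norm (x (Suc (s j)) - x (s j)))\<^sup>2"
      using alpha_gamma_pos[of "s j"] by simp
    then show ?thesis using prox_le[OF z, of "s j"] by simp
  qed
  \<comment> \<open>g need not be continuous: lower semicontinuity bounds its values from below and
    \<open>?h\<close> from above. The limiting subdifferential requires this convergence of
    values.\<close>
  have g_lim: "(\<lambda>j. gr (x (Suc (s j)))) \<longlonglongrightarrow> gr z"
  proof (rule order_tendstoI)
    fix a assume "a < gr z"
    then have "\<forall>\<^sub>F j in sequentially. ereal a < g (x (Suc (s j)))"
      by (intro lsc_eventually_less[OF lsc_g u]) (simp add: g_real[OF z])
    then show "\<forall>\<^sub>F j in sequentially. a < gr (x (Suc (s j)))"
      by (simp add: g_real[OF x_dom])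
  next
    fix a assume "gr z < a"
    then have "\<forall>\<^sub>F j in sequentially. ?h j < a"
      by (rule order_tendstoD(2)[OF h_lim])
    then show "\<forall>\<^sub>F j in sequentially. gr (x (Suc (s j))) < a"
      by eventually_elim (use g_le le_less_trans in blast)
  qed
  have F_lim: "(\<lambda>j. f (x (Suc (s j))) + g (x (Suc (s j)))) \<longlonglongrightarrow> f z + g z"
    using tendsto_add[OF f_lim g_lim]
    by (simp add: f_real[OF x_dom] g_real[OF x_dom] f_real[OF z] g_real[OF z])

  let ?\<xi> = "\<lambda>j. grad f (x (Suc (s j))) - grad f (x (s j))
      - (\<alpha> * \<gamma> (Suc (s j))) *\<^sub>R (x (Suc (s j)) - x (s j))"
  have "(\<lambda>j. (\<alpha> * \<gamma> (Suc (s j))) *\<^sub>R (x (Suc (s j)) - x (s j))) \<longlonglongrightarrow> 0"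
  proof (rule tendsto_norm_zero_cancel)
    show "(\<lambda>j. norm ((\<alpha> * \<gamma> (Suc (s j))) *\<^sub>R (x (Suc (s j)) - x (s j)))) \<longlonglongrightarrow> 0"
      using bounded[OF st] alpha_gamma_pos
      by (simp add: step_def less_imp_le abs_of_pos del: abs_mult)
  qed
  then have "?\<xi> \<longlonglongrightarrow> grad f z - grad f z - 0"
    by (intro tendsto_diff gu gw)
  then have "?\<xi> \<longlonglongrightarrow> 0" by simp
  then have "0 \<in> limiting_subdiff (\<lambda>y. f y + g y) z"
    unfolding limiting_subdiff_def
    using u F_lim subgradient by (intro CollectI exI[of _ "\<lambda>j. x (Suc (s j))"] exI[of _ ?\<xi>]) auto
  then show ?thesis using z by (simp add: l_stationary_def)
qed

section \<open>The bound on the gradient mapping\<close>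

lemma min_grad_map_le:
  assumes m: "m \<ge> 0"
    and bad: "\<And>k. (\<alpha> + 1) / 2 * \<gamma> (Suc k) < L (Suc k) \<Longrightarrow> (step k)\<^sup>2 \<le> m"
    and k: "k \<ge> 1"
  shows "Min ((\<lambda>l. norm (grad_map \<alpha> x \<gamma> l)) ` {1..k})
    \<le> sqrt (2 * \<alpha>\<^sup>2 * max L\<^sub>0 L\<^sub>f
        * (2 * (Fx 0 - real_of_ereal (INF y. f y + g y)) + (max L\<^sub>0 L\<^sub>f - L\<^sub>0) * m)
        / ((\<alpha> - 1) * real k))"
proof -
  let ?gap = "Fx 0 - real_of_ereal (INF y. f y + g y)" and ?M = "max L\<^sub>0 L\<^sub>f"
  let ?K = "2 * \<alpha>\<^sup>2 * ?M * (2 * ?gap + (?M - L\<^sub>0) * m) / (\<alpha> - 1)"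
  let ?T = "\<Sum>l<k. \<gamma> (Suc l) * (step l)\<^sup>2"
  have "(\<Sum>l=1..k. (norm (grad_map \<alpha> x \<gamma> l))\<^sup>2) = (\<Sum>l<k. (norm (grad_map \<alpha> x \<gamma> (Suc l)))\<^sup>2)"
    by (simp add: sum.atLeast1_atMost_eq)
  also have "\<dots> \<le> (\<Sum>l<k. \<alpha>\<^sup>2 * ?M * (\<gamma> (Suc l) * (step l)\<^sup>2))"
  proof (rule sum_mono)
    fix l
    \<comment> \<open>Of the two factors \<gamma>, one is estimated by its upper bound and the other
      is kept as the weight in the summed descent.\<close>
    have "(norm (grad_map \<alpha> x \<gamma> (Suc l)))\<^sup>2 = \<gamma> (Suc l) * (\<alpha>\<^sup>2 * (\<gamma> (Suc l) * (step l)\<^sup>2))"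
      by (simp add: grad_map_def step_def norm_minus_commute power_mult_distrib power2_eq_square)
    also have "\<dots> \<le> ?M * (\<alpha>\<^sup>2 * (\<gamma> (Suc l) * (step l)\<^sup>2))"
      using gamma_pos[of l] by (intro mult_right_mono gamma_le) auto
    finally show "(norm (grad_map \<alpha> x \<gamma> (Suc l)))\<^sup>2 \<le> \<alpha>\<^sup>2 * ?M * (\<gamma> (Suc l) * (step l)\<^sup>2)"
      by (simp add: mult_ac)
  qed
  also have "\<dots> = \<alpha>\<^sup>2 * ?M * ?T" by (simp add: sum_distrib_left)
  also have "\<dots> \<le> \<alpha>\<^sup>2 * ?M * ((2 * (2 * ?gap + (?M - L\<^sub>0) * m)) / (\<alpha> - 1))"
  proof (rule mult_left_mono)
    have "?T * (\<alpha> - 1) \<le> 2 * (2 * ?gap + (?M - L\<^sub>0) * m)"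
      using sum_step_le_gap[OF m bad, of k] by (simp add: field_simps)
    then show "?T \<le> (2 * (2 * ?gap + (?M - L\<^sub>0) * m)) / (\<alpha> - 1)"
      using alpha by (simp add: pos_le_divide_eq)
    show "0 \<le> \<alpha>\<^sup>2 * ?M" using L0 by (simp add: le_max_iff_disj)
  qed
  also have "\<dots> = ?K" by simp
  finally have "(\<Sum>l=1..k. (norm (grad_map \<alpha> x \<gamma> l))\<^sup>2) \<le> ?K" .
  from Min_le_sqrt_average[OF k _ this] show ?thesis
    by (simp add: divide_divide_eq_left)
qed

end

section \<open>Attainment of the maximum in C and transfer to extended reals\<close>

theorem theorem2p1:
  fixes f g F :: "'a::euclidean_space \<Rightarrow> ereal"
    and x :: "nat \<Rightarrow> 'a" and \<gamma> L :: "nat \<Rightarrow> real"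
    and x\<^sub>0 :: 'a and \<alpha> \<beta> L\<^sub>0 L\<^sub>f \<Delta> :: real
    and S S' :: "nat set" and M C :: ereal and bound :: "nat \<Rightarrow> real"
  defines "F \<equiv> \<lambda>y. f y + g y"
    and "\<beta> \<equiv> (\<alpha> + 1) / 2"
    and "S \<equiv> {k. 1 \<le> k \<and> \<beta> * \<gamma> k \<ge> L k}"
    and "S' \<equiv> {1..} - S"
    and "\<Delta> \<equiv> real_of_ereal (F x\<^sub>0) - real_of_ereal (INF y. F y)"
    and "M \<equiv> emax0 ((\<lambda>l. ereal ((norm (x l - x (l - 1)))\<^sup>2)) ` S')"
    and "C \<equiv> ereal (max L\<^sub>0 L\<^sub>f - L\<^sub>0) * M"
    and "bound \<equiv> \<lambda>k. sqrt (2 * \<alpha>\<^sup>2 * max L\<^sub>0 L\<^sub>f * (2 * \<Delta> + real_of_ereal C) / ((\<alpha> - 1) * real k))"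
  assumes "\<And>y. - \<infinity> < f y" and "lsc f"
    and "\<exists>U. edom g \<subseteq> U \<and> C1_on f U"
    and "proper g" and "lsc g"
    and "- \<infinity> < (INF y. F y)"
    and "\<And>c y. c > 0 \<Longrightarrow> prox g c y \<noteq> {}"
    and "L\<^sub>f > 0"
    and "\<And>y z. y \<in> edom g \<Longrightarrow> z \<in> edom g \<Longrightarrow>
           f y \<le> f z + ereal (inner (grad f z) (y - z) + L\<^sub>f / 2 * (norm (y - z))\<^sup>2)"
    and "\<alpha> > 1" and "L\<^sub>0 > 0" and "x\<^sub>0 \<in> edom g"
    and "ac_pgm f g \<alpha> L\<^sub>0 x\<^sub>0 x \<gamma> L"
    and "\<And>k. 1 \<le> k \<Longrightarrow> x k \<noteq> x (k - 1)"
  shows "((S' \<noteq> {} \<longrightarrow> (\<exists>l\<in>S'. M = ereal ((norm (x l - x (l - 1)))\<^sup>2))) \<and> C < \<infinity> \<and>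
          (\<forall>k\<ge>1. Min ((\<lambda>l. norm (grad_map \<alpha> x \<gamma> l)) ` {1..k}) \<le> bound k) \<and>
          bound \<in> O(\<lambda>k. real k powr (- 1 / 2)))
       \<and> ((\<exists>c::real. (\<lambda>k. F (x k)) \<longlonglongrightarrow> ereal c) \<and>
          (\<forall>z. accumulation_point x z \<longrightarrow> l_stationary f g z))"
proof -
  obtain U where U: "edom g \<subseteq> U" "C1_on f U" using assms(11) by blast
  interpret ac_pgm_run f g \<alpha> L\<^sub>0 L\<^sub>f x\<^sub>0 x \<gamma> L U
    using assms(9-) U unfolding F_def by unfold_locales auto
  let ?n = "\<lambda>l. (norm (x l - x (l - 1)))\<^sup>2"
  \<comment> \<open>Zero lies outside both index sets, so bad indices are exactly successors,
    matching the indexing of \<open>step\<close>.\<close>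
  have S': "S' = Suc ` {k. \<beta> * \<gamma> (Suc k) < L (Suc k)}"
  proof (rule set_eqI)
    fix l show "l \<in> S' \<longleftrightarrow> l \<in> Suc ` {k. \<beta> * \<gamma> (Suc k) < L (Suc k)}"
      unfolding S'_def S_def by (cases l) auto
  qed
  then have fin: "finite S'" using finite_bad unfolding \<beta>_def by simp
  have att: "\<exists>l\<in>S'. M = ereal (?n l)" if "S' \<noteq> {}"
  proof -
    have "Sup ((\<lambda>l. ereal (?n l)) ` S') \<in> (\<lambda>l. ereal (?n l)) ` S'"
      using fin that by (subst Max_Sup[symmetric]) (auto intro: Max_in)
    then show ?thesis using that unfolding M_def emax0_def by auto
  qed
  \<comment> \<open>Without bad indices the convention for the empty maximum gives 0; otherwise the
    attained value is a square.\<close>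
  obtain m where m: "M = ereal m" "m \<ge> 0"
  proof (cases "S' = {}")
    case True
    then have "M = ereal 0" by (simp add: M_def emax0_def zero_ereal_def)
    then show ?thesis using that by blast
  next
    case False
    then show ?thesis using att that by fastforce
  qed
  have bad: "(step k)\<^sup>2 \<le> m" if "(\<alpha> + 1) / 2 * \<gamma> (Suc k) < L (Suc k)" for k
  proof -
    have "Suc k \<in> S'" using that by (auto simp: S' \<beta>_def)
    then have "ereal (?n (Suc k)) \<le> M"
      unfolding M_def emax0_def by (auto intro!: SUP_upper2[of "Suc k"])
    then show ?thesis by (simp add: m step_def)
  qed
  have C: "C = ereal ((max L\<^sub>0 L\<^sub>f - L\<^sub>0) * m)" by (simp add: C_def m)
  have "x 0 = x\<^sub>0" using run by (simp add: ac_pgm_def)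
  then have \<Delta>: "\<Delta> = Fx 0 - real_of_ereal (INF y. f y + g y)"
    using F_real[of 0] by (simp add: \<Delta>_def F_def)
  have bound: "Min ((\<lambda>l. norm (grad_map \<alpha> x \<gamma> l)) ` {1..k}) \<le> bound k" if "k \<ge> 1" for k
    using min_grad_map_le[OF m(2) bad that] by (simp add: bound_def C \<Delta>)
  have O: "bound \<in> O(\<lambda>k. real k powr (- 1 / 2))"
    unfolding bound_def by (rule sqrt_inverse_bigo)
  obtain c where "Fx \<longlonglongrightarrow> c" using Fx_converges by blast
  then have "(\<lambda>k. F (x k)) \<longlonglongrightarrow> ereal c" by (simp add: F_def F_real)
  then show ?thesis
    using att C bound O accumulation_l_stationary by auto
qed

end
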